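(* Let $\varphi$ be a Boolean CNF formula with $n$ variables and $m=O(n)$ clauses. There is a non-interactive protocol where: (i) Alice, given $\varphi$, a partial assignment $\alpha\in\{0,1\}^{n/2}$ to the first half of the variables, and advice $\mu\in\{0,1\}^{o(n)}$, outputs a string $a^{\alpha,\mu}\in\{0,1\}^{2^{o(n)}}$; (ii) Bob, given $\varphi$ and a partial assignment $\beta\in\{0,1\}^{n/2}$ to the second half of the variables, outputs a string $b^{\beta}\in\{0,1\}^{2^{o(n)}}$; (iii) the verifier, given $\varphi$, tosses $o(n)$ coins, non-adaptively reads $o(n)$ bits of $b^\beta$, and adaptively reads one bit of $a^{\alpha,\mu}$; it then returns Accept or Reject. If the combined assignment $(\alpha,\beta)$ satisfies $\varphi$, then there exists advice $\mu^*$ such that the verifier always accepts. Otherwise (in particular if $\varphi$ is unsatisfiable), for every $\mu$ the verifier rejects with probability at least $1-1/2^{n^{1-o(1)}}$.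
   Context: Alice's output depends only on $(\varphi,\alpha,\mu)$ and Bob's output only on $(\varphi,\beta)$; the verifier has query access to both strings. *)

theory Defs
  imports "HOL-Probability.Probability" "HOL-Library.Landau_Symbols"
begin

datatype literal = Pos nat | Neg nat

fun lit_var :: "literal \<Rightarrow> nat" where
  "lit_var (Pos i) = i"
| "lit_var (Neg i) = i"

fun lit_true :: "bool list \<Rightarrow> literal \<Rightarrow> bool" where
  "lit_true x (Pos i) = x ! i"
| "lit_true x (Neg i) = (\<not> x ! i)"

text \<open>A CNF formula carries its number of variables; not every variable has to occur.
  Clauses may have any width, and the empty clause is false.\<close>

record cnf =
  num_vars :: nat
  clauses :: "literal list list"

definition wf_cnf :: "cnf \<Rightarrow> bool" where
  "wf_cnf \<phi> \<longleftrightarrow> (\<forall>C \<in> set (clauses \<phi>). \<forall>l \<in> set C. lit_var l < num_vars \<phi>)"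

definition satisfies :: "bool list \<Rightarrow> cnf \<Rightarrow> bool" where
  "satisfies x \<phi> \<longleftrightarrow> (\<forall>C \<in> set (clauses \<phi>). \<exists>l \<in> set C. lit_true x l)"

definition bitstrings :: "nat \<Rightarrow> bool list set" where
  "bitstrings k = {x. length x = k}"

text \<open>Alice takes the formula, \<open>\<alpha>\<close> and \<open>\<mu>\<close>; Bob takes the formula and \<open>\<beta>\<close>.
  The positions read in Bob's string depend on the formula and the coins only (non-adaptive);
  the position read in Alice's string may also depend on the bits read from Bob (adaptive).
  The decision sees the formula, the coins, the bits read from Bob, and the one bit of Alice.\<close>

record protocol =
  alice :: "cnf \<Rightarrow> bool list \<Rightarrow> bool list \<Rightarrow> bool list"
  bob :: "cnf \<Rightarrow> bool list \<Rightarrow> bool list"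
  bob_queries :: "cnf \<Rightarrow> bool list \<Rightarrow> nat list"
  alice_query :: "cnf \<Rightarrow> bool list \<Rightarrow> bool list \<Rightarrow> nat"
  decision :: "cnf \<Rightarrow> bool list \<Rightarrow> bool list \<Rightarrow> bool \<Rightarrow> bool"

definition accepts :: "protocol \<Rightarrow> cnf \<Rightarrow> bool list \<Rightarrow> bool list \<Rightarrow> bool list \<Rightarrow> bool" where
  "accepts P \<phi> a b r \<longleftrightarrow>
     (let ys = map (\<lambda>i. b ! i) (bob_queries P \<phi> r)
      in decision P \<phi> r ys (a ! alice_query P \<phi> r ys))"

definition reject_prob ::
    "nat \<Rightarrow> protocol \<Rightarrow> cnf \<Rightarrow> bool list \<Rightarrow> bool list \<Rightarrow> real" where
  "reject_prob coins P \<phi> a b =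
     measure_pmf.prob (pmf_of_set (bitstrings coins)) {r. \<not> accepts P \<phi> a b r}"

text \<open>On \<open>\<phi>\<close>, the protocol uses \<open>adv\<close> bits of advice, strings of lengths \<open>la\<close> (Alice) and
  \<open>lb\<close> (Bob), \<open>coins\<close> coin tosses and \<open>qb\<close> queries to Bob's string, all of them in range.\<close>

definition well_formed_on ::
    "protocol \<Rightarrow> cnf \<Rightarrow> nat \<Rightarrow> nat \<Rightarrow> nat \<Rightarrow> nat \<Rightarrow> nat \<Rightarrow> bool" where
  "well_formed_on P \<phi> adv la lb coins qb \<longleftrightarrow>
     (\<forall>\<alpha> \<in> bitstrings (num_vars \<phi> div 2). \<forall>\<mu> \<in> bitstrings adv.
        alice P \<phi> \<alpha> \<mu> \<in> bitstrings la) \<and>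
     (\<forall>\<beta> \<in> bitstrings (num_vars \<phi> div 2). bob P \<phi> \<beta> \<in> bitstrings lb) \<and>
     (\<forall>r \<in> bitstrings coins.
        length (bob_queries P \<phi> r) = qb \<and>
        (\<forall>i \<in> set (bob_queries P \<phi> r). i < lb) \<and>
        (\<forall>ys \<in> bitstrings qb. alice_query P \<phi> r ys < la))"

definition little_o_n :: "(nat \<Rightarrow> nat) \<Rightarrow> bool" where
  "little_o_n f \<longleftrightarrow> (\<lambda>n. real (f n)) \<in> o(\<lambda>n. real n)"

definition two_to_little_o_n :: "(nat \<Rightarrow> nat) \<Rightarrow> bool" where
  "two_to_little_o_n f \<longleftrightarrow>
     (\<exists>g :: nat \<Rightarrow> real. g \<in> o(\<lambda>n. real n) \<and> (\<forall>n. real (f n) = 2 powr g n))"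

end

theory Submission
  imports Defs "HOL-Computational_Algebra.Polynomial" "HOL-Number_Theory.Cong"
    "HOL-Real_Asymp.Real_Asymp"
begin

text \<open>The assignment satisfies the formula iff no clause is failed both by \<open>\<alpha>\<close> and by \<open>\<beta>\<close>, an
  instance of set disjointness, for which we use the Aaronson--Wigderson protocol. The clauses form
  a matrix with \<open>T\<close> rows and \<open>D\<close> columns; each row of failure bits is encoded by a polynomial of
  degree below \<open>D\<close> (\<open>A\<^sub>t\<close> for Alice, \<open>B\<^sub>t\<close> for Bob), and the advice claims the coefficients of
  \<open>\<Sum>\<^sub>t A\<^sub>t B\<^sub>t\<close> modulo a prime \<open>q\<close>. Alice checks that the claimed polynomial vanishes at the column
  indices, which the true one does iff the sets are disjoint. So a false claim differs from the
  truth and agrees with it on at most \<open>2D\<close> of the \<open>2\<^sup>s\<close> sample points. A round reads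
  \<open>B\<^sub>1(x), \<dots>, B\<^sub>T(x)\<close> from Bob; Alice's string tabulates her verdict for all coin tosses and all
  answers of Bob, so that one bit of it suffices. With \<open>2\<^sup>s \<approx> n\<close>, \<open>T = s\<^sup>2\<close>, \<open>D \<approx> m / s\<^sup>2\<close> and \<open>log q = O(s)\<close>,
  about \<open>n / s\<^sup>4\<close> independent rounds cost \<open>O(n / s)\<close> coins and queries and bring the error down to
  \<open>2^(-k)\<close> with \<open>k \<approx> n / s\<^sup>4\<close>.\<close>

subsection \<open>A prime of logarithmic bit length\<close>

text \<open>Induction along the Leibniz triangle: with \<open>L(n, k) = 1 / (k * (n choose k))\<close> one has
  \<open>L(n, k) + L(n, k + 1) = L(n - 1, k)\<close>.\<close>

lemma mult_binomial_dvd_common_multiple: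
  fixes d :: nat
  assumes "k \<ge> 1" and "\<And>i. 1 \<le> i \<Longrightarrow> i \<le> k + j \<Longrightarrow> i dvd d"
  shows "k * ((k + j) choose k) dvd d"
  using assms
proof (induction j arbitrary: k)
  case 0
  then show ?case by simp
next
  case (Suc j)
  define B where "B = (k + j) choose k"
  define C where "C = Suc (k + j) choose k"
  have B0: "B > 0" by (simp add: B_def)
  have "k * B dvd d"
    unfolding B_def using Suc.prems by (intro Suc.IH) auto
  then obtain a where a: "d = k * B * a" by blast
  have "Suc k * ((Suc k + j) choose Suc k) dvd d"
    using Suc.prems by (intro Suc.IH) auto
  moreover have "Suc k * ((Suc k + j) choose Suc k) = Suc (k + j) * B"
    using Suc_times_binomial[of k "k + j"] by (simp add: B_def)
  ultimately obtain b where b: "d = Suc (k + j) * B * b" by (metis dvdE)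
  have C: "Suc j * C = Suc (k + j) * B"
    using binomial_absorb_comp[of "Suc (k + j)" k] by (simp add: B_def C_def Suc_diff_le)
  \<comment> \<open>This is the triangle identity for n = \<open>k + j + 1\<close>, multiplied by
    \<open>d\<close>: here \<open>a\<close> is d L(n - 1, k) and \<open>b\<close> is d L(n, k + 1),
    so \<open>a - b\<close> is d L(n, k). Both sides are multiplied by the denominators of
    \<open>a\<close> and \<open>b\<close>, which are cancelled at the end.\<close>
  have eq: "int k * int C * (int a - int b) = int d"
  proof -
    have "int (k * B) * int (Suc (k + j) * B) * (int k * int C * (int a - int b))
        = int k * int C * (int (Suc (k + j) * B) * int (k * B * a)
            - int (k * B) * int (Suc (k + j) * B * b))"
      by (simp add: algebra_simps)
    also have "\<dots> = int k * int C * (int (Suc (k + j) * B) * int d - int (k * B) * int d)"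
      by (simp only: a[symmetric] b[symmetric])
    also have "\<dots> = int d * int k * int B * int (Suc j * C)"
      by (simp add: algebra_simps)
    also have "\<dots> = int (k * B) * int (Suc (k + j) * B) * int d"
      unfolding C by (simp add: algebra_simps)
    finally show ?thesis
      using B0 \<open>k \<ge> 1\<close> by (simp del: of_nat_Suc of_nat_add)
  qed
  then have "int (k * C) dvd int d"
    by (metis dvd_triv_left of_nat_mult)
  then have "k * C dvd d" by (simp only: of_nat_dvd_iff)
  then show ?case by (simp add: C_def)
qed

text \<open>Chebyshev's argument: \<open>d\<close> is the least common multiple of 1, ..., 2M,
  written as the product of the largest prime powers up to 2M. It is a multiple of the central
  binomial coefficient and has at most \<open>N\<close> factors, each at most 2M.\<close>

lemma central_binomial_le_prime_bound:
  fixes M N :: nat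
  assumes "M \<ge> 1" and small: "\<And>p. prime p \<Longrightarrow> p \<le> 2 * M \<Longrightarrow> p \<le> N"
  shows "(2 * M) choose M \<le> (2 * M) ^ N"
proof -
  define Q where "Q = {p. prime p \<and> p \<le> N}"
  define e where "e p = Max {a. p ^ a \<le> 2 * M}" for p
  define d where "d = (\<Prod>p\<in>Q. p ^ e p)"
  have fin: "finite {a. p ^ a \<le> 2 * M}" if "prime p" for p
  proof (rule finite_subset)
    have "a < p ^ a" for a
      using prime_gt_1_nat[OF that] by (simp add: power_gt_expt)
    then show "{a. p ^ a \<le> 2 * M} \<subseteq> {..2 * M}"
      by (auto intro: le_trans less_imp_le)
  qed simp
  have finQ: "finite Q" unfolding Q_def by simp
  have d0: "d > 0" unfolding d_def using finQ by (auto simp: Q_def prime_gt_0_nat intro!: prod_pos)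
  have i_dvd: "i dvd d" if i: "1 \<le> i" "i \<le> 2 * M" for i
  proof (rule multiplicity_le_imp_dvd)
    show "i \<noteq> 0" using i by simp
    fix p :: nat assume p: "prime p"
    show "multiplicity p i \<le> multiplicity p d"
    proof (cases "p dvd i")
      case True
      then have "p \<le> 2 * M" using i dvd_imp_le[of p i] by simp
      then have pQ: "p \<in> Q" using p small by (simp add: Q_def)
      have "p ^ multiplicity p i \<le> 2 * M"
        using multiplicity_dvd[of p i] i dvd_imp_le[of _ i] by (meson le_trans less_le_trans zero_less_one)
      then have "multiplicity p i \<le> e p"
        unfolding e_def using fin[OF p] by (intro Max_ge) auto
      also have "e p \<le> multiplicity p d"
      proof (rule multiplicity_geI)
        show "p ^ e p dvd d" unfolding d_def using pQ finQ by (rule dvd_prodI[rotated])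
      qed (use d0 p prime_gt_1_nat in auto)
      finally show ?thesis .
    next
      case False
      then show ?thesis by (simp add: not_dvd_imp_multiplicity_0)
    qed
  qed
  have "M * ((M + M) choose M) dvd d"
    using assms(1) i_dvd by (intro mult_binomial_dvd_common_multiple) auto
  then have "(2 * M) choose M dvd d"
    by (metis dvd_mult_right mult_2)
  then have "(2 * M) choose M \<le> d" using d0 by (rule dvd_imp_le)
  also have "d \<le> (\<Prod>p\<in>Q. 2 * M)"
    unfolding d_def
  proof (rule prod_mono, safe)
    fix p assume "p \<in> Q"
    then have "prime p" by (simp add: Q_def)
    have "e p \<in> {a. p ^ a \<le> 2 * M}"
      unfolding e_def using fin[OF \<open>prime p\<close>] assms(1)
      by (intro Max_in) (auto intro!: exI[of _ 0])
    then show "p ^ e p \<le> 2 * M" by simp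
  qed
  also have "\<dots> = (2 * M) ^ card Q" by simp
  also have "\<dots> \<le> (2 * M) ^ N"
  proof (rule power_increasing)
    have "Q \<subseteq> {1..N}" by (auto simp: Q_def dest: prime_ge_1_nat)
    then have "card Q \<le> card {1..N}" by (intro card_mono) auto
    then show "card Q \<le> N" by simp
  qed (use assms(1) in simp)
  finally show ?thesis .
qed

text \<open>Otherwise all primes up to 2M = \<open>2 ^ (4 * s + 4)\<close> are at most
  \<open>4 ^ s\<close>, so the central binomial coefficient is at most
  \<open>(2 * M) ^ (4 ^ s)\<close>. It is also at least 4^M / (2M), hence at least 2^M, and M = 8 *
  16^s is too large for both bounds. The lower end lets the prime exceed the number of sample points
  and of rows; the upper end bounds its bit length.\<close>

lemma exists_prime_between_powers:
  "\<exists>q::nat. prime q \<and> 4 ^ s < q \<and> q \<le> 2 ^ (4 * s + 4)"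
proof (rule ccontr)
  assume no: "\<not> ?thesis"
  define M :: nat where "M = 2 ^ (4 * s + 3)"
  have M: "2 * M = 2 ^ (4 * s + 4)" by (simp add: M_def power_add)
  have "(2 * M) choose M \<le> (2 * M) ^ (4 ^ s)"
  proof (rule central_binomial_le_prime_bound)
    show "1 \<le> M" by (simp add: M_def)
    show "p \<le> 4 ^ s" if "prime p" "p \<le> 2 * M" for p
      using no that unfolding M by (meson not_less)
  qed
  moreover have "2 ^ M \<le> (2 * M) choose M"
  proof -
    have "4 * s + 4 \<le> M"
      unfolding M_def using less_exp[of "4 * s + 3"] by linarith
    then have "2 * M \<le> 2 ^ M" unfolding M by (rule power_increasing) simp
    then have "real (2 * M) \<le> 2 ^ M" by (metis of_nat_le_iff of_nat_numeral of_nat_power)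
    have "real (2 ^ M) = 4 ^ M / 2 ^ M" by (simp add: power_divide[symmetric])
    also have "\<dots> \<le> 4 ^ M / real (2 * M)"
      using \<open>real (2 * M) \<le> 2 ^ M\<close> by (intro divide_left_mono) (auto simp: M_def)
    also have "\<dots> \<le> real ((2 * M) choose M)"
      using central_binomial_lower_bound[of M] by (simp add: M_def)
    finally show ?thesis by (simp only: of_nat_le_iff)
  qed
  ultimately have "2 ^ M \<le> (2 * M) ^ (4 ^ s)" by (rule order.trans[rotated])
  also have "\<dots> = 2 ^ ((4 * s + 4) * 4 ^ s)" unfolding M by (rule power_mult[symmetric])
  finally have "M \<le> (4 * s + 4) * 4 ^ s"
    by (rule power_le_imp_le_exp[rotated]) simp
  moreover have "M = (8 * 4 ^ s) * 4 ^ s"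
    by (simp add: M_def power_add power_mult power_mult_distrib[symmetric])
  ultimately have "8 * 4 ^ s \<le> 4 * s + (4::nat)" by simp
  moreover have "s < 4 ^ s" by (simp add: power_gt_expt)
  ultimately show False by linarith
qed

subsection \<open>The set disjointness protocol\<close>

text \<open>Induction on the degree bound, splitting off one root at a time. Division by the monic X
  - a stays within integer polynomials, and being nonzero modulo \<open>q\<close> is expressed
  through values, so coefficients are never reduced and the leading one may be divisible by
  \<open>q\<close>.\<close>

lemma card_roots_mod_prime_le:
  fixes p :: "int poly" and q :: nat
  assumes "prime q" and "degree p \<le> d" and "\<not> (\<forall>x. int q dvd poly p x)"
  shows "card {x. x < q \<and> int q dvd poly p (int x)} \<le> d"
  using assms(2,3)
proof (induction d arbitrary: p)
  case 0
  then obtain c where "p = [:c:]" by (metis degree_eq_zeroE le_zero_eq)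
  with 0 show ?case by simp
next
  case (Suc d)
  let ?R = "\<lambda>p. {x. x < q \<and> int q dvd poly p (int x)}"
  show ?case
  proof (cases "?R p = {}")
    case True
    then show ?thesis by (simp only: card.empty)
  next
    case False
    then obtain a where a: "a < q" "int q dvd poly p (int a)" by auto
    define g where "g = synthetic_div p (int a)"
    have p_eq: "poly p x = (x - int a) * poly g x + poly p (int a)" for x
      using arg_cong[OF synthetic_div_correct'[of "int a" p], of "\<lambda>r. poly r x"]
      by (simp add: g_def algebra_simps)
    \<comment> \<open>The remainder \<open>poly p (int a)\<close> vanishes modulo \<open>q\<close>,
      so \<open>p\<close> factors modulo \<open>q\<close> and primality splits the product.\<close>
    have dvd_iff: "int q dvd poly p x \<longleftrightarrow> int q dvd (x - int a) \<or> int q dvd poly g x" for x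
      using a(2) \<open>prime q\<close> p_eq[of x]
      by (simp add: dvd_add_left_iff prime_dvd_mult_iff)
    have "card (?R g) \<le> d"
    proof (rule Suc.IH)
      show "degree g \<le> d" using Suc.prems(1) by (simp add: g_def degree_synthetic_div)
      show "\<not> (\<forall>x. int q dvd poly g x)" using Suc.prems(2) dvd_iff by blast
    qed
    moreover have "?R p \<subseteq> insert a (?R g)"
    proof safe
      fix x assume "x < q" "int q dvd poly p (int x)" "x \<noteq> a"
      moreover have "\<not> int q dvd int x - int a"
        using \<open>x < q\<close> a(1) \<open>x \<noteq> a\<close> dvd_imp_le_int[of "int x - int a" "int q"] by auto
      ultimately show "int q dvd poly g (int x)" using dvd_iff by blast
    qed
    then have "card (?R p) \<le> card (insert a (?R g))" by (intro card_mono) auto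
    moreover have "card (insert a (?R g)) \<le> Suc (card (?R g))" by (rule card_insert_le_m1) auto
    ultimately show ?thesis by linarith
  qed
qed

text \<open>The numerator of a Lagrange basis polynomial. Leaving out the normalising denominator keeps
  the coefficients integral and only scales the value at the node \<open>i\<close> by a unit modulo \<open>q\<close>.\<close>

definition node_poly :: "nat \<Rightarrow> nat \<Rightarrow> int poly" where
  "node_poly D i = (\<Prod>j\<in>{..<D} - {i}. [:- int j, 1:])"

text \<open>The matrix is stored row by row: index \<open>t * D + i\<close> is row \<open>t\<close>,
  column \<open>i\<close>.\<close>

definition row_poly :: "nat \<Rightarrow> (nat \<Rightarrow> bool) \<Rightarrow> nat \<Rightarrow> int poly" where
  "row_poly D f t = (\<Sum>i<D. smult (of_bool (f (t * D + i))) (node_poly D i))"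

definition overlap_poly :: "nat \<Rightarrow> nat \<Rightarrow> (nat \<Rightarrow> bool) \<Rightarrow> (nat \<Rightarrow> bool) \<Rightarrow> int poly" where
  "overlap_poly D T f g = (\<Sum>t<T. row_poly D f t * row_poly D g t)"

section \<open>Degrees and node values of the polynomials\<close>

lemma degree_node_poly_le: "degree (node_poly D i) \<le> D"
proof -
  have "degree (node_poly D i) \<le> (\<Sum>j\<in>{..<D} - {i}. 1)"
    unfolding node_poly_def by (rule order.trans[OF degree_prod_sum_le]) auto
  also have "\<dots> \<le> card {..<D}" by (simp only: card_eq_sum[symmetric]) (intro card_mono, auto)
  finally show ?thesis by simp
qed

lemma degree_row_poly_le: "degree (row_poly D f t) \<le> D"
  unfolding row_poly_def
  by (intro degree_sum_le) (auto intro: order.trans[OF degree_smult_le degree_node_poly_le]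
      degree_node_poly_le)

lemma degree_overlap_poly_le: "degree (overlap_poly D T f g) \<le> 2 * D"
  unfolding overlap_poly_def
proof (intro degree_sum_le)
  fix t
  show "degree (row_poly D f t * row_poly D g t) \<le> 2 * D"
    using degree_mult_le[of "row_poly D f t" "row_poly D g t"]
      degree_row_poly_le[of D f t] degree_row_poly_le[of D g t] by linarith
qed simp

lemma poly_node_poly_other: "i < D \<Longrightarrow> i \<noteq> j \<Longrightarrow> poly (node_poly D j) (int i) = 0"
  unfolding node_poly_def poly_prod by (rule prod_zero) auto

lemma poly_row_poly:
  assumes "i < D"
  shows "poly (row_poly D f t) (int i) = of_bool (f (t * D + i)) * poly (node_poly D i) (int i)"
proof -
  have "poly (row_poly D f t) (int i)
      = (\<Sum>j<D. if j = i then of_bool (f (t * D + i)) * poly (node_poly D i) (int i) else 0)"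
    unfolding row_poly_def poly_sum
    by (rule sum.cong) (use assms in \<open>auto simp: poly_node_poly_other\<close>)
  then show ?thesis using assms by simp
qed

text \<open>Each row in which both bits of column \<open>i\<close> are set contributes the same
  square, so the value at the node is the number of such rows times that square. The base of the
  square is a unit modulo \<open>q\<close> as the nodes are distinct modulo \<open>q\<close>, and
  the count cannot wrap around to 0 because it is at most \<open>T < q\<close>.\<close>

lemma dvd_poly_overlap_poly_iff:
  assumes "prime q" "D \<le> q" "T < q" "i < D"
  shows "int q dvd poly (overlap_poly D T f g) (int i)
           \<longleftrightarrow> (\<forall>t<T. \<not> (f (t * D + i) \<and> g (t * D + i)))"
proof -
  define S where "S = {t. t < T \<and> f (t * D + i) \<and> g (t * D + i)}"
  let ?c = "poly (node_poly D i) (int i)"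
  have "finite S" by (auto simp: S_def)
  have "card S \<le> card {..<T}" by (intro card_mono) (auto simp: S_def)
  then have "card S < q" using assms by simp
  have "poly (overlap_poly D T f g) (int i) = (\<Sum>t<T. if t \<in> S then ?c\<^sup>2 else 0)"
    unfolding overlap_poly_def poly_sum
    by (rule sum.cong) (auto simp: poly_row_poly[OF assms(4)] S_def power2_eq_square)
  also have "\<dots> = (\<Sum>t\<in>S. ?c\<^sup>2)"
    by (rule sum.mono_neutral_cong_right) (auto simp: S_def)
  finally have eq: "poly (overlap_poly D T f g) (int i) = int (card S) * ?c\<^sup>2"
    by simp
  have "\<not> int q dvd ?c"
  proof
    assume "int q dvd ?c"
    then obtain j where "j < D" "j \<noteq> i" "int q dvd int i - int j"
      using assms(1) by (auto simp: node_poly_def poly_prod prime_dvd_prod_iff)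
    then show False
      using assms dvd_imp_le_int[of "int i - int j" "int q"] by auto
  qed
  then have "int q dvd poly (overlap_poly D T f g) (int i) \<longleftrightarrow> q dvd card S"
    using assms(1) by (auto simp: eq prime_dvd_mult_iff prime_dvd_power_iff)
  also have "\<dots> \<longleftrightarrow> card S = 0"
    using \<open>card S < q\<close> by (auto dest: dvd_imp_le)
  also have "\<dots> \<longleftrightarrow> S = {}" using \<open>finite S\<close> by simp
  finally show ?thesis by (auto simp: S_def)
qed

lemma dvd_poly:
  fixes p :: "'a::comm_ring_1 poly"
  assumes "\<And>j. c dvd coeff p j"
  shows "c dvd poly p x"
  unfolding poly_altdef by (intro dvd_sum dvd_mult2 assms)

section \<open>Encoding residue vectors by bit strings\<close>

lemma finite_bitstrings: "finite (bitstrings k)"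
  and card_bitstrings: "card (bitstrings k) = 2 ^ k"
proof -
  have eq: "bitstrings k = {x. set x \<subseteq> UNIV \<and> length x = k}" by (simp add: bitstrings_def)
  show "finite (bitstrings k)" unfolding eq by (rule finite_lists_length_eq) simp
  show "card (bitstrings k) = 2 ^ k" unfolding eq by (subst card_lists_length_eq) auto
qed

text \<open>Any injection will do: the parties are arbitrary functions, so only the length of a code
  word matters.\<close>

lemma bitstring_encoding:
  assumes "finite S" "card S \<le> 2 ^ k"
  shows "\<exists>enc dec. \<forall>v\<in>S. enc v \<in> bitstrings k \<and> dec (enc v) = v"
proof -
  obtain enc where "enc ` S \<subseteq> bitstrings k" "inj_on enc S"
    using card_le_inj[OF assms(1) finite_bitstrings[of k]] assms(2) by (auto simp: card_bitstrings)
  then show ?thesis by (intro exI[of _ enc] exI[of _ "inv_into S enc"]) auto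
qed

lemma residue_list_encoding:
  assumes "q \<le> 2 ^ L"
  shows "\<exists>enc dec. \<forall>v. length v = N \<longrightarrow> set v \<subseteq> {0..<int q} \<longrightarrow>
    enc v \<in> bitstrings (N * L) \<and> dec (enc v) = v"
proof -
  let ?S = "{v. set v \<subseteq> {0..<int q} \<and> length v = N}"
  have "card ?S = q ^ N" by (subst card_lists_length_eq) auto
  also have "\<dots> \<le> (2 ^ L) ^ N" using assms by (rule power_mono) simp
  finally have "card ?S \<le> 2 ^ (N * L)" by (simp add: power_mult[symmetric] mult.commute)
  moreover have "finite ?S" by (rule finite_lists_length_eq) simp
  ultimately have "\<exists>enc dec. \<forall>v\<in>?S. enc v \<in> bitstrings (N * L) \<and> dec (enc v) = v"
    by (intro bitstring_encoding)
  then show ?thesis by (simp add: imp_conjL) metis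
qed

text \<open>A single round at sample point \<open>x\<close>: \<open>B g x\<close> is Bob's vector of
  row values modulo \<open>q\<close>, and \<open>test\<close> is Alice's verdict on it. A claim that
  vanishes at all nodes differs modulo \<open>q\<close> from the true overlap polynomial at the
  column of a common element \<open>j\<close>, so they agree on at most \<open>2 * D\<close> sample
  points, at most half of them.\<close>

lemma disjointness_test:
  fixes q s L T D :: nat
  assumes q: "prime q" "q \<le> 2 ^ L" "2 ^ s \<le> q" and "T < q" and D: "4 * D \<le> 2 ^ s"
  obtains B :: "(nat \<Rightarrow> bool) \<Rightarrow> nat \<Rightarrow> bool list"
    and test :: "(nat \<Rightarrow> bool) \<Rightarrow> bool list \<Rightarrow> nat \<Rightarrow> bool list \<Rightarrow> bool"
  where "\<And>g x. B g x \<in> bitstrings (T * L)"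
    and "\<And>f g. \<forall>j<T * D. \<not> (f j \<and> g j) \<Longrightarrow>
           \<exists>\<mu>\<in>bitstrings ((2 * D + 1) * L). \<forall>x. test f \<mu> x (B g x)"
    and "\<And>f g \<mu> j. j < T * D \<Longrightarrow> f j \<Longrightarrow> g j \<Longrightarrow>
           2 * card {x. x < 2 ^ s \<and> test f \<mu> x (B g x)} \<le> 2 ^ s"
proof -
  have q0: "q > 0" using q by (simp add: prime_gt_0_nat)
  have "D \<le> q" using q D by linarith
  obtain enc dec where ed: "\<And>v. length v = T \<Longrightarrow> set v \<subseteq> {0..<int q} \<Longrightarrow>
      enc v \<in> bitstrings (T * L) \<and> dec (enc v) = v"
    using residue_list_encoding[OF q(2)] by metis
  obtain menc mdec where med: "\<And>v. length v = 2 * D + 1 \<Longrightarrow> set v \<subseteq> {0..<int q} \<Longrightarrow>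
      menc v \<in> bitstrings ((2 * D + 1) * L) \<and> mdec (menc v) = v"
    using residue_list_encoding[OF q(2)] by metis
  define vals where "vals g x = map (\<lambda>t. poly (row_poly D g t) (int x) mod int q) [0..<T]" for g x
  define B where "B g x = enc (vals g x)" for g x
  define G where "G \<mu> = Poly (mdec \<mu>)" for \<mu>
  \<comment> \<open>The degree has to be tested, since decoding a dishonest advice string may give a
    list of any length. The root count depends on this bound.\<close>
  define test where "test f \<mu> x w \<longleftrightarrow> degree (G \<mu>) \<le> 2 * D \<and> (\<forall>i<D. int q dvd poly (G \<mu>) (int i)) \<and>
      int q dvd (poly (G \<mu>) (int x) - (\<Sum>t<T. poly (row_poly D f t) (int x) * dec w ! t))"
    for f \<mu> x w
  have vals: "length (vals g x) = T" "set (vals g x) \<subseteq> {0..<int q}" for g x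
    using q0 by (auto simp: vals_def)
  have test_iff: "test f \<mu> x (B g x) \<longleftrightarrow> degree (G \<mu>) \<le> 2 * D \<and>
      (\<forall>i<D. int q dvd poly (G \<mu>) (int i)) \<and>
      int q dvd poly (G \<mu> - overlap_poly D T f g) (int x)" for f g \<mu> x
  proof -
    \<comment> \<open>Alice evaluates her row polynomials over the integers, whereas Bob's values
      arrive reduced, so the two sums agree only modulo \<open>q\<close>.\<close>
    have "[(\<Sum>t<T. poly (row_poly D f t) (int x) * dec (B g x) ! t)
        = (\<Sum>t<T. poly (row_poly D f t) (int x) * poly (row_poly D g t) (int x))] (mod int q)"
      using ed[OF vals, of g x]
      by (intro cong_sum cong_mult) (auto simp: B_def vals_def cong_def)
    then have "[poly (G \<mu>) (int x) - (\<Sum>t<T. poly (row_poly D f t) (int x) * dec (B g x) ! t)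
        = poly (G \<mu> - overlap_poly D T f g) (int x)] (mod int q)"
      by (auto simp: overlap_poly_def poly_sum intro!: cong_diff)
    then show ?thesis
      unfolding test_def by (simp only: cong_dvd_iff)
  qed
  show thesis
  proof
    show "B g x \<in> bitstrings (T * L)" for g x
      using ed[OF vals] by (simp add: B_def)
  next
    fix f g assume disj: "\<forall>j<T * D. \<not> (f j \<and> g j)"
    define v where "v = map (\<lambda>j. coeff (overlap_poly D T f g) j mod int q) [0..<2 * D + 1]"
    define \<mu> where "\<mu> = menc v"
    have "length v = 2 * D + 1" "set v \<subseteq> {0..<int q}" using q0 by (auto simp: v_def)
    then have \<mu>: "\<mu> \<in> bitstrings ((2 * D + 1) * L)" "G \<mu> = Poly v"
      using med[of v] by (auto simp: \<mu>_def G_def)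
    have G0: "coeff (G \<mu>) j = 0" if "j > 2 * D" for j
      using that by (simp add: \<mu>(2) nth_default_def v_def)
    \<comment> \<open>Above \<open>2 * D\<close> both polynomials have coefficient 0; below, the
      claim is the true coefficient reduced. Coefficientwise congruence then gives congruence at all
      integers, covering nodes and sample points alike.\<close>
    have "int q dvd coeff (G \<mu> - overlap_poly D T f g) j" for j
    proof (cases "j > 2 * D")
      case True
      then show ?thesis
        using G0[OF True] degree_overlap_poly_le[of D T f g] by (simp add: coeff_eq_0)
    next
      case False
      then have "coeff (G \<mu>) j = coeff (overlap_poly D T f g) j mod int q"
        by (simp add: \<mu>(2) nth_default_def v_def del: upt_Suc)
      then show ?thesis by (simp add: mod_eq_dvd_iff[symmetric])
    qed
    then have dvd: "int q dvd poly (G \<mu> - overlap_poly D T f g) x" for x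
      by (rule dvd_poly)
    have "int q dvd poly (G \<mu>) (int i)" if "i < D" for i
    proof -
      have "t * D + i < T * D" if "t < T" for t
      proof -
        have "t * D + i < Suc t * D" using \<open>i < D\<close> by simp
        also have "\<dots> \<le> T * D" using that by (intro mult_right_mono) auto
        finally show ?thesis .
      qed
      then have "int q dvd poly (overlap_poly D T f g) (int i)"
        using disj by (subst dvd_poly_overlap_poly_iff[OF q(1) \<open>D \<le> q\<close> \<open>T < q\<close> \<open>i < D\<close>]) auto
      then show ?thesis using dvd[of "int i"] by (simp add: dvd_diff_left_iff)
    qed
    moreover have "degree (G \<mu>) \<le> 2 * D" using G0 by (intro degree_le) auto
    ultimately have "\<forall>x. test f \<mu> x (B g x)" using dvd by (simp add: test_iff)
    then show "\<exists>\<mu>\<in>bitstrings ((2 * D + 1) * L). \<forall>x. test f \<mu> x (B g x)" using \<mu>(1) by blast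
  next
    fix f g \<mu> j assume j: "j < T * D" "f j" "g j"
    let ?H = "G \<mu> - overlap_poly D T f g"
    let ?A = "{x. x < 2 ^ s \<and> test f \<mu> x (B g x)}"
    show "2 * card ?A \<le> 2 ^ s"
    proof (cases "degree (G \<mu>) \<le> 2 * D \<and> (\<forall>i<D. int q dvd poly (G \<mu>) (int i))")
      case True
      define i where "i = j mod D"
      have "D > 0" using j(1) by (cases D) auto
      then have i: "i < D" "j = (j div D) * D + i" "j div D < T"
        using j(1) by (auto simp: i_def less_mult_imp_div_less)
      then have "\<not> int q dvd poly (overlap_poly D T f g) (int i)"
        using dvd_poly_overlap_poly_iff[OF q(1) \<open>D \<le> q\<close> \<open>T < q\<close> i(1), of f g] j(2,3) by metis
      then have "\<not> int q dvd poly ?H (int i)"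
        using True i(1) by (simp add: dvd_diff_right_iff)
      moreover have "degree ?H \<le> 2 * D"
        using True degree_overlap_poly_le by (intro degree_diff_le) auto
      ultimately have "card {x. x < q \<and> int q dvd poly ?H (int x)} \<le> 2 * D"
        using q(1) by (intro card_roots_mod_prime_le) auto
      moreover have "card ?A \<le> card {x. x < q \<and> int q dvd poly ?H (int x)}"
        using q(3) by (intro card_mono) (auto simp: test_iff)
      ultimately show ?thesis using D by linarith
    next
      case False
      then have "?A = {}" by (auto simp: test_iff)
      then show ?thesis by (simp only: card.empty)
    qed
  qed
qed

subsection \<open>Parallel repetition as a protocol\<close>

text \<open>Alice's table has one entry for each pair of a coin string and an answer string of Bob,
  so she can fill it without knowing \<beta>; the verifier then looks up the pair that occurred.
  Rounds use independent points and each accepts with probability at most 1/2 in the rejecting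
  case.\<close>

lemma parallel_repetition:
  fixes test :: "bool list \<Rightarrow> bool list \<Rightarrow> nat \<Rightarrow> bool list \<Rightarrow> bool"
    and B :: "bool list \<Rightarrow> nat \<Rightarrow> bool list"
  assumes B: "\<And>\<beta> x. B \<beta> x \<in> bitstrings W"
  obtains P :: protocol where
    "\<And>\<phi> adv. well_formed_on P \<phi> adv (2 ^ (k * s + k * W)) (2 ^ s * W) (k * s) (k * W)"
    "\<And>\<phi> \<alpha> \<beta> \<mu>. \<forall>x<2 ^ s. test \<alpha> \<mu> x (B \<beta> x) \<Longrightarrow>
       \<forall>r\<in>bitstrings (k * s). accepts P \<phi> (alice P \<phi> \<alpha> \<mu>) (bob P \<phi> \<beta>) r"
    "\<And>\<phi> \<alpha> \<beta> \<mu>. 2 * card {x. x < 2 ^ s \<and> test \<alpha> \<mu> x (B \<beta> x)} \<le> 2 ^ s \<Longrightarrow>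
       reject_prob (k * s) P \<phi> (alice P \<phi> \<alpha> \<mu>) (bob P \<phi> \<beta>) \<ge> 1 - 1 / 2 ^ k"
proof -
  define K where "K = k * s + k * W"
  define tuples where "tuples = {xs::nat list. set xs \<subseteq> {..<2 ^ s} \<and> length xs = k}"
  have "finite tuples" unfolding tuples_def by (rule finite_lists_length_eq) simp
  have "card tuples = (2 ^ s) ^ k" unfolding tuples_def by (subst card_lists_length_eq) auto
  also have "\<dots> = card (bitstrings (k * s))"
    by (simp add: card_bitstrings power_mult[symmetric] mult.commute)
  \<comment> \<open>A bijection, so that uniform coins yield a uniform \<open>k\<close>-tuple of
    sample points.\<close>
  finally obtain pts where pts: "bij_betw pts (bitstrings (k * s)) tuples"
    using finite_same_card_bij[OF finite_bitstrings \<open>finite tuples\<close>] by metis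
  obtain idx where idx: "bij_betw idx (bitstrings K) {..<2 ^ K :: nat}"
    using finite_same_card_bij[OF finite_bitstrings, of "{..<2 ^ K :: nat}" K]
    by (auto simp: card_bitstrings)
  \<comment> \<open>Bob's string is the concatenation of his answers for all \<open>x\<close>; the
    answer for \<open>x\<close> is the block starting at \<open>x * W\<close>.\<close>
  define queries where "queries xs = concat (map (\<lambda>x. map (\<lambda>j. x * W + j) [0..<W]) xs)" for xs
  define bb where "bb \<beta> = map (\<lambda>i. B \<beta> (i div W) ! (i mod W)) [0..<2 ^ s * W]" for \<beta>
  \<comment> \<open>The existential cuts \<open>ys\<close> into one block of length \<open>W\<close>
    per round. Fixed lengths make the cut unique, as \<open>concat_injective\<close> confirms
    below.\<close>
  define rounds where "rounds \<alpha> \<mu> xs ys \<longleftrightarrow>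
      (\<exists>ws. concat ws = ys \<and> set ws \<subseteq> bitstrings W \<and> list_all2 (test \<alpha> \<mu>) xs ws)" for \<alpha> \<mu> xs ys
  define aa where "aa \<alpha> \<mu> = map (\<lambda>i. let w = inv_into (bitstrings K) idx i
      in rounds \<alpha> \<mu> (pts (take (k * s) w)) (drop (k * s) w)) [0..<2 ^ K]" for \<alpha> \<mu>
  define P :: protocol where "P = \<lparr>alice = (\<lambda>_. aa), bob = (\<lambda>_. bb),
      bob_queries = (\<lambda>_ r. queries (pts r)), alice_query = (\<lambda>_ r ys. idx (r @ ys)),
      decision = (\<lambda>_ _ _ c. c)\<rparr>"
  have pts_in: "set (pts r) \<subseteq> {..<2 ^ s}" "length (pts r) = k" if "r \<in> bitstrings (k * s)" for r
    using bij_betwE[OF pts] that by (auto simp: tuples_def)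
  have len_queries: "length (queries xs) = length xs * W" for xs
    by (induction xs) (auto simp: queries_def)
  have block_lt: "x * W + j < 2 ^ s * W" if "x < 2 ^ s" "j < W" for x j
  proof -
    have "x * W + j < Suc x * W" using that by simp
    also have "\<dots> \<le> 2 ^ s * W" using that by (intro mult_right_mono) auto
    finally show ?thesis .
  qed
  have idx_lt: "idx (r @ ys) < 2 ^ K" if "r \<in> bitstrings (k * s)" "ys \<in> bitstrings (k * W)" for r ys
    using bij_betwE[OF idx] that by (auto simp: bitstrings_def K_def)
  have answers: "map (\<lambda>i. bb \<beta> ! i) (queries xs) = concat (map (B \<beta>) xs)"
    if "set xs \<subseteq> {..<2 ^ s}" for \<beta> xs
  proof -
    have "map (\<lambda>j. bb \<beta> ! (x * W + j)) [0..<W] = B \<beta> x" if "x \<in> set xs" for x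
    proof (rule nth_equalityI)
      show "length (map (\<lambda>j. bb \<beta> ! (x * W + j)) [0..<W]) = length (B \<beta> x)"
        using B by (simp add: bitstrings_def)
      fix j assume "j < length (map (\<lambda>j. bb \<beta> ! (x * W + j)) [0..<W])"
      then show "map (\<lambda>j. bb \<beta> ! (x * W + j)) [0..<W] ! j = B \<beta> x ! j"
        using \<open>set xs \<subseteq> {..<2 ^ s}\<close> \<open>x \<in> set xs\<close> block_lt[of x j] by (auto simp: bb_def)
    qed
    then show ?thesis
      by (auto simp: queries_def map_concat o_def intro!: arg_cong[of _ _ concat])
  qed
  have accepts_iff: "accepts P \<phi> (aa \<alpha> \<mu>) (bb \<beta>) r \<longleftrightarrow> (\<forall>x\<in>set (pts r). test \<alpha> \<mu> x (B \<beta> x))"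
    if r: "r \<in> bitstrings (k * s)" for \<phi> \<alpha> \<beta> \<mu> r
  proof -
    define ys where "ys = concat (map (B \<beta>) (pts r))"
    have "length ys = k * W"
      unfolding ys_def answers[OF pts_in(1)[OF r], symmetric]
      using pts_in(2)[OF r] by (simp add: len_queries)
    then have ry: "r @ ys \<in> bitstrings K" "idx (r @ ys) < 2 ^ K"
      using r idx_lt[OF r, of ys] by (auto simp: bitstrings_def K_def)
    have "accepts P \<phi> (aa \<alpha> \<mu>) (bb \<beta>) r \<longleftrightarrow> aa \<alpha> \<mu> ! idx (r @ ys)"
      by (simp add: accepts_def P_def answers[OF pts_in(1)[OF r]] ys_def)
    also have "\<dots> \<longleftrightarrow> rounds \<alpha> \<mu> (pts r) ys"
      using ry r bij_betw_inv_into_left[OF idx ry(1)] by (simp add: aa_def bitstrings_def)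
    also have "\<dots> \<longleftrightarrow> list_all2 (test \<alpha> \<mu>) (pts r) (map (B \<beta>) (pts r))"
    proof
      assume "rounds \<alpha> \<mu> (pts r) ys"
      then obtain ws where ws: "concat ws = ys" "set ws \<subseteq> bitstrings W"
          "list_all2 (test \<alpha> \<mu>) (pts r) ws" by (auto simp: rounds_def)
      have "ws = map (B \<beta>) (pts r)"
      proof (rule concat_injective)
        show "concat ws = concat (map (B \<beta>) (pts r))" by (simp add: ws ys_def)
        show "length ws = length (map (B \<beta>) (pts r))"
          using list_all2_lengthD[OF ws(3)] by simp
        show "\<forall>(x, y)\<in>set (zip ws (map (B \<beta>) (pts r))). length x = length y"
          using ws(2) B by (fastforce simp: bitstrings_def dest: set_zip_leftD set_zip_rightD)
      qed
      with ws show "list_all2 (test \<alpha> \<mu>) (pts r) (map (B \<beta>) (pts r))" by simp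
    next
      assume "list_all2 (test \<alpha> \<mu>) (pts r) (map (B \<beta>) (pts r))"
      then show "rounds \<alpha> \<mu> (pts r) ys"
        using B by (auto simp: rounds_def ys_def intro!: exI[of _ "map (B \<beta>) (pts r)"])
    qed
    also have "\<dots> \<longleftrightarrow> (\<forall>x\<in>set (pts r). test \<alpha> \<mu> x (B \<beta> x))"
      by (simp add: list_all2_map2 list.rel_refl_strong list_all2_same)
    finally show ?thesis .
  qed
  have P_simps: "alice P \<phi> = aa" "bob P \<phi> = bb" for \<phi> by (simp_all add: P_def)
  show thesis
  proof
    show "well_formed_on P \<phi> adv (2 ^ (k * s + k * W)) (2 ^ s * W) (k * s) (k * W)" for \<phi> adv
      unfolding well_formed_on_def P_simps K_def[symmetric]
    proof (intro conjI ballI)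
      fix r assume r: "r \<in> bitstrings (k * s)"
      show "length (bob_queries P \<phi> r) = k * W"
        using pts_in(2)[OF r] by (simp add: P_def len_queries)
      show "i < 2 ^ s * W" if i: "i \<in> set (bob_queries P \<phi> r)" for i
      proof -
        obtain x where x: "x \<in> set (pts r)" "x * W \<le> i" "i < W + x * W"
          using i by (auto simp: P_def queries_def)
        then show ?thesis
          using pts_in(1)[OF r] block_lt[of x "i - x * W"] by auto
      qed
      show "alice_query P \<phi> r ys < 2 ^ K" if "ys \<in> bitstrings (k * W)" for ys
        using idx_lt[OF r that] by (simp add: P_def)
    qed (auto simp: aa_def bb_def bitstrings_def)
  next
    fix \<phi> \<alpha> \<beta> \<mu>
    assume "\<forall>x<2 ^ s. test \<alpha> \<mu> x (B \<beta> x)"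
    then show "\<forall>r\<in>bitstrings (k * s). accepts P \<phi> (alice P \<phi> \<alpha> \<mu>) (bob P \<phi> \<beta>) r"
      using pts_in(1) by (auto simp: P_simps accepts_iff)
  next
    fix \<phi> \<alpha> \<beta> \<mu>
    define A where "A = {x. x < 2 ^ s \<and> test \<alpha> \<mu> x (B \<beta> x)}"
    assume A: "2 * card {x. x < 2 ^ s \<and> test \<alpha> \<mu> x (B \<beta> x)} \<le> 2 ^ s"
    let ?C = "bitstrings (k * s)"
    let ?Acc = "{r \<in> ?C. accepts P \<phi> (aa \<alpha> \<mu>) (bb \<beta>) r}"
    have "finite A" by (simp add: A_def)
    have "inj_on pts ?Acc" using pts by (auto simp: bij_betw_def intro: inj_on_subset)
    then have "card ?Acc = card (pts ` ?Acc)" by (simp add: card_image)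
    \<comment> \<open>Accepting means that every point of the tuple lies in \<open>A\<close>, so
      accepting coins inject into the \<open>k\<close>-tuples over \<open>A\<close>.\<close>
    also have "\<dots> \<le> card {xs. set xs \<subseteq> A \<and> length xs = k}"
      using pts_in \<open>finite A\<close>
      by (intro card_mono finite_lists_length_eq) (fastforce simp: accepts_iff A_def)+
    also have "\<dots> = card A ^ k" using \<open>finite A\<close> by (simp add: card_lists_length_eq)
    finally have "2 ^ k * card ?Acc \<le> (2 * card A) ^ k" by (simp add: power_mult_distrib)
    also have "\<dots> \<le> (2 ^ s) ^ k" using A by (intro power_mono) (auto simp: A_def)
    also have "\<dots> = card ?C" by (simp add: card_bitstrings power_mult[symmetric] mult.commute)
    finally have "real (2 ^ k * card ?Acc) \<le> real (card ?C)" by (simp only: of_nat_le_iff)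
    then have le: "real (card ?Acc) / real (card ?C) \<le> 1 / 2 ^ k"
      by (simp add: card_bitstrings field_simps)
    have ne: "?C \<noteq> {}" by (metis card.empty card_bitstrings power_not_zero zero_neq_numeral)
    have "reject_prob (k * s) P \<phi> (aa \<alpha> \<mu>) (bb \<beta>)
        = 1 - measure_pmf.prob (pmf_of_set ?C) {r. accepts P \<phi> (aa \<alpha> \<mu>) (bb \<beta>) r}"
      unfolding reject_prob_def
      using measure_pmf.prob_neg[of "pmf_of_set ?C" "\<lambda>r. accepts P \<phi> (aa \<alpha> \<mu>) (bb \<beta>) r"] by simp
    also have "measure_pmf.prob (pmf_of_set ?C) {r. accepts P \<phi> (aa \<alpha> \<mu>) (bb \<beta>) r}
        = real (card ?Acc) / real (card ?C)"
      by (simp add: measure_pmf_of_set[OF ne finite_bitstrings] Int_def)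
    finally show "reject_prob (k * s) P \<phi> (alice P \<phi> \<alpha> \<mu>) (bob P \<phi> \<beta>) \<ge> 1 - 1 / 2 ^ k"
      using le by (simp add: P_simps)
  qed
qed

subsection \<open>CNF formulas and the choice of parameters\<close>

text \<open>Indices past the last clause never fail, so the unfilled entries of the matrix cause no
  overlap.\<close>

definition alice_fails :: "cnf \<Rightarrow> bool list \<Rightarrow> nat \<Rightarrow> bool" where
  "alice_fails \<phi> \<alpha> j \<longleftrightarrow> j < length (clauses \<phi>) \<and>
     (\<forall>l\<in>set (clauses \<phi> ! j). lit_var l < num_vars \<phi> div 2 \<longrightarrow> \<not> lit_true \<alpha> l)"

text \<open>The \<open>replicate\<close> prefix shifts \<beta> to the positions of the second half
  of the variables.\<close>

definition bob_fails :: "cnf \<Rightarrow> bool list \<Rightarrow> nat \<Rightarrow> bool" where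
  "bob_fails \<phi> \<beta> j \<longleftrightarrow> j < length (clauses \<phi>) \<and>
     (\<forall>l\<in>set (clauses \<phi> ! j). \<not> lit_var l < num_vars \<phi> div 2 \<longrightarrow>
        \<not> lit_true (replicate (num_vars \<phi> div 2) False @ \<beta>) l)"

lemma lit_true_append:
  "lit_true (\<alpha> @ \<beta>) l \<longleftrightarrow>
     (if lit_var l < length \<alpha> then lit_true \<alpha> l
      else lit_true (replicate (length \<alpha>) False @ \<beta>) l)"
  by (cases l) (auto simp: nth_append)

text \<open>Every literal belongs to exactly one half, so a clause is false exactly when both halves
  fail it. This turns satisfaction into disjointness.\<close>

lemma satisfies_append_iff:
  assumes "\<alpha> \<in> bitstrings (num_vars \<phi> div 2)"
  shows "satisfies (\<alpha> @ \<beta>) \<phi> \<longleftrightarrow> (\<forall>j. \<not> (alice_fails \<phi> \<alpha> j \<and> bob_fails \<phi> \<beta> j))"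
proof -
  have len: "length \<alpha> = num_vars \<phi> div 2" using assms by (simp add: bitstrings_def)
  have "satisfies (\<alpha> @ \<beta>) \<phi> \<longleftrightarrow>
      (\<forall>j<length (clauses \<phi>). \<exists>l\<in>set (clauses \<phi> ! j). lit_true (\<alpha> @ \<beta>) l)"
    unfolding satisfies_def by (metis in_set_conv_nth)
  also have "\<dots> \<longleftrightarrow> (\<forall>j. \<not> (alice_fails \<phi> \<alpha> j \<and> bob_fails \<phi> \<beta> j))"
    unfolding alice_fails_def bob_fails_def lit_true_append[of \<alpha> \<beta>] len by metis
  finally show ?thesis .
qed

text \<open>Here \<phi> is fixed first and built into the test, so the protocol obtained may depend
  on it. The theorem later merges these protocols into one.\<close>

lemma formula_protocol:
  fixes q s L T D k :: nat
  assumes "prime q" "q \<le> 2 ^ L" "2 ^ s \<le> q" "T < q" "4 * D \<le> 2 ^ s"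
    and size: "length (clauses \<phi>) \<le> T * D"
  obtains P :: protocol where
    "well_formed_on P \<phi> ((2 * D + 1) * L) (2 ^ (k * s + k * (T * L))) (2 ^ s * (T * L))
       (k * s) (k * (T * L))"
    "\<And>\<alpha> \<beta>. \<alpha> \<in> bitstrings (num_vars \<phi> div 2) \<Longrightarrow> satisfies (\<alpha> @ \<beta>) \<phi> \<Longrightarrow>
       \<exists>\<mu>\<in>bitstrings ((2 * D + 1) * L). \<forall>r\<in>bitstrings (k * s).
         accepts P \<phi> (alice P \<phi> \<alpha> \<mu>) (bob P \<phi> \<beta>) r"
    "\<And>\<alpha> \<beta> \<mu>. \<alpha> \<in> bitstrings (num_vars \<phi> div 2) \<Longrightarrow> \<not> satisfies (\<alpha> @ \<beta>) \<phi> \<Longrightarrow>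
       reject_prob (k * s) P \<phi> (alice P \<phi> \<alpha> \<mu>) (bob P \<phi> \<beta>) \<ge> 1 - 1 / 2 ^ k"
proof -
  obtain B :: "(nat \<Rightarrow> bool) \<Rightarrow> nat \<Rightarrow> bool list"
    and test :: "(nat \<Rightarrow> bool) \<Rightarrow> bool list \<Rightarrow> nat \<Rightarrow> bool list \<Rightarrow> bool"
    where B: "\<And>g x. B g x \<in> bitstrings (T * L)"
    and complete: "\<And>f g. \<forall>j<T * D. \<not> (f j \<and> g j) \<Longrightarrow>
           \<exists>\<mu>\<in>bitstrings ((2 * D + 1) * L). \<forall>x. test f \<mu> x (B g x)"
    and sound: "\<And>f g \<mu> j. j < T * D \<Longrightarrow> f j \<Longrightarrow> g j \<Longrightarrow>
           2 * card {x. x < 2 ^ s \<and> test f \<mu> x (B g x)} \<le> 2 ^ s"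
    by (rule disjointness_test[OF assms(1-5)]) (rule that)
  obtain P where
      wf: "\<And>\<phi> adv. well_formed_on P \<phi> adv (2 ^ (k * s + k * (T * L))) (2 ^ s * (T * L)) (k * s)
             (k * (T * L))"
    and acc: "\<And>\<psi> \<alpha> \<beta> \<mu>.
       \<forall>x<2 ^ s. test (alice_fails \<phi> \<alpha>) \<mu> x (B (bob_fails \<phi> \<beta>) x) \<Longrightarrow>
       \<forall>r\<in>bitstrings (k * s). accepts P \<psi> (alice P \<psi> \<alpha> \<mu>) (bob P \<psi> \<beta>) r"
    and rej: "\<And>\<psi> \<alpha> \<beta> \<mu>.
       2 * card {x. x < 2 ^ s \<and> test (alice_fails \<phi> \<alpha>) \<mu> x (B (bob_fails \<phi> \<beta>) x)} \<le> 2 ^ s \<Longrightarrow>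
       reject_prob (k * s) P \<psi> (alice P \<psi> \<alpha> \<mu>) (bob P \<psi> \<beta>) \<ge> 1 - 1 / 2 ^ k"
    by (rule parallel_repetition[where B = "\<lambda>\<beta>. B (bob_fails \<phi> \<beta>)"
        and test = "\<lambda>\<alpha>. test (alice_fails \<phi> \<alpha>)" and W = "T * L" and s = s and k = k, OF B]) (rule that)
  show thesis
  proof
    show "well_formed_on P \<phi> ((2 * D + 1) * L) (2 ^ (k * s + k * (T * L))) (2 ^ s * (T * L))
       (k * s) (k * (T * L))" by (rule wf)
  next
    fix \<alpha> \<beta> assume "\<alpha> \<in> bitstrings (num_vars \<phi> div 2)" "satisfies (\<alpha> @ \<beta>) \<phi>"
    then obtain \<mu> where "\<mu> \<in> bitstrings ((2 * D + 1) * L)"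
        "\<forall>x. test (alice_fails \<phi> \<alpha>) \<mu> x (B (bob_fails \<phi> \<beta>) x)"
      using complete[of "alice_fails \<phi> \<alpha>" "bob_fails \<phi> \<beta>"] satisfies_append_iff by blast
    then show "\<exists>\<mu>\<in>bitstrings ((2 * D + 1) * L). \<forall>r\<in>bitstrings (k * s).
         accepts P \<phi> (alice P \<phi> \<alpha> \<mu>) (bob P \<phi> \<beta>) r"
      using acc by blast
  next
    fix \<alpha> \<beta> \<mu> assume "\<alpha> \<in> bitstrings (num_vars \<phi> div 2)" "\<not> satisfies (\<alpha> @ \<beta>) \<phi>"
    then obtain j where j: "alice_fails \<phi> \<alpha> j" "bob_fails \<phi> \<beta> j"
      using satisfies_append_iff by blast
    then have "j < T * D" using size by (simp add: alice_fails_def)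
    then show "reject_prob (k * s) P \<phi> (alice P \<phi> \<alpha> \<mu>) (bob P \<phi> \<beta>) \<ge> 1 - 1 / 2 ^ k"
      using j by (intro rej sound)
  qed
qed

text \<open>Thus \<open>s\<close> is of logarithmic order: the upper bound makes powers of
  \<open>s\<close> negligible against \<open>n\<close>, and divergence makes \<open>n / s\<close>
  sublinear.\<close>

lemma log_scale_asymp:
  fixes m :: "nat \<Rightarrow> nat" and s :: "nat \<Rightarrow> nat"
  assumes "(\<lambda>n. real (m n)) \<in> O(\<lambda>n. real n)"
    and lower: "\<And>n. n \<le> 2 ^ s n" and upper: "\<And>n. 2 ^ s n \<le> 8 * (m n + n + 1)"
  shows "(\<lambda>n. real (s n)) \<in> O(\<lambda>n. ln (real n))"
    and "filterlim (\<lambda>n. real (s n)) at_top at_top"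
proof -
  obtain c where c: "eventually (\<lambda>n. real (m n) \<le> c * real n) at_top"
    using landau_o.bigE[OF assms(1)] by auto
  \<comment> \<open>For n at least 1, m + n + 1 is eventually at most (|c| + 2) n.\<close>
  define C where "C = 8 * (\<bar>c\<bar> + 2)"
  have "eventually (\<lambda>n. real (s n) \<le> log 2 C + log 2 (real n)) at_top"
    using c eventually_ge_at_top[of 1]
  proof eventually_elim
    case (elim n)
    have "real (m n) \<le> \<bar>c\<bar> * real n" using elim(1) by (meson abs_ge_self mult_right_mono of_nat_0_le_iff order.trans)
    have "2 powr real (s n) = real (2 ^ s n)" by (simp add: powr_realpow)
    also have "\<dots> \<le> real (8 * (m n + n + 1))" using upper of_nat_le_iff by blast
    also have "\<dots> \<le> C * real n"
      using \<open>real (m n) \<le> \<bar>c\<bar> * real n\<close> elim(2) by (simp add: C_def algebra_simps)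
    finally have "real (s n) \<le> log 2 (C * real n)"
      using elim(2) by (subst le_log_iff) (auto simp: C_def)
    also have "\<dots> = log 2 C + log 2 (real n)"
      using elim(2) by (subst log_mult) (auto simp: C_def)
    finally show ?case .
  qed
  then have "(\<lambda>n. real (s n)) \<in> O(\<lambda>n. log 2 C + log 2 (real n))"
    by (intro bigoI[of _ 1]) (auto elim!: eventually_mono)
  also have "(\<lambda>n. log 2 C + log 2 (real n)) \<in> O(\<lambda>n. ln (real n))" by real_asymp
  finally show "(\<lambda>n. real (s n)) \<in> O(\<lambda>n. ln (real n))" .
  have "eventually (\<lambda>n. log 2 (real n) \<le> real (s n)) at_top"
    using eventually_ge_at_top[of 1]
  proof eventually_elim
    case (elim n)
    have "real n \<le> real (2 ^ s n)" using lower of_nat_le_iff by blast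
    then show ?case using elim by (subst log_le_iff) (auto simp: powr_realpow)
  qed
  moreover have "filterlim (\<lambda>n. log 2 (real n)) at_top at_top" by real_asymp
  ultimately show "filterlim (\<lambda>n. real (s n)) at_top at_top"
    by (rule filterlim_at_top_mono[rotated])
qed

section \<open>Choice of parameters, and one protocol for all formulas\<close>

theorem theorem11:
  fixes m :: "nat \<Rightarrow> nat"
  assumes "(\<lambda>n. real (m n)) \<in> O(\<lambda>n. real n)"
  shows "\<exists>(P :: protocol) (adv :: nat \<Rightarrow> nat) (la :: nat \<Rightarrow> nat) (lb :: nat \<Rightarrow> nat)
           (coins :: nat \<Rightarrow> nat) (qb :: nat \<Rightarrow> nat) (\<delta> :: nat \<Rightarrow> real).
      little_o_n adv \<and> two_to_little_o_n la \<and> two_to_little_o_n lb \<and>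
      little_o_n coins \<and> little_o_n qb \<and> \<delta> \<in> o(\<lambda>n. 1) \<and>
      (\<forall>(\<phi> :: cnf) (n :: nat).
         wf_cnf \<phi> \<and> num_vars \<phi> = n \<and> even n \<and> length (clauses \<phi>) \<le> m n \<longrightarrow>
           well_formed_on P \<phi> (adv n) (la n) (lb n) (coins n) (qb n) \<and>
           (\<forall>\<alpha> \<in> bitstrings (n div 2). \<forall>\<beta> \<in> bitstrings (n div 2).
              (satisfies (\<alpha> @ \<beta>) \<phi> \<longrightarrow>
                 (\<exists>\<mu> \<in> bitstrings (adv n). \<forall>r \<in> bitstrings (coins n).
                    accepts P \<phi> (alice P \<phi> \<alpha> \<mu>) (bob P \<phi> \<beta>) r)) \<and>
              (\<not> satisfies (\<alpha> @ \<beta>) \<phi> \<longrightarrow>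
                 (\<forall>\<mu> \<in> bitstrings (adv n).
                    reject_prob (coins n) P \<phi> (alice P \<phi> \<alpha> \<mu>) (bob P \<phi> \<beta>)
                      \<ge> 1 - 1 / 2 powr (real n powr (1 - \<delta> n))))))"
proof -
  \<comment> \<open>The lower bound yields \<open>4 * D n \<le> 2 ^ s n\<close> and
    \<open>2 \<le> s n\<close> for every \<open>n\<close>; the upper bound keeps \<open>s\<close>
    logarithmic.\<close>
  have "\<exists>s::nat. 4 * (m n + n + 1) \<le> 2 ^ s \<and> 2 ^ s \<le> 8 * (m n + n + 1)" for n
  proof -
    obtain e where "2 ^ e < 4 * (m n + n + 1)" "4 * (m n + n + 1) \<le> 2 ^ (e + 1)"
      using ex_power_ivl2[of 2 "4 * (m n + n + 1)"] by auto
    then show ?thesis by (intro exI[of _ "e + 1"]) simp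
  qed
  then obtain s :: "nat \<Rightarrow> nat"
    where s_ge: "\<And>n. 4 * (m n + n + 1) \<le> 2 ^ s n" and s_le: "\<And>n. 2 ^ s n \<le> 8 * (m n + n + 1)"
    by metis
  define L where "L n = 4 * s n + 4" for n
  define T where "T n = s n ^ 2" for n
  \<comment> \<open>Adding 1 rounds up, so that \<open>T n * D n\<close> exceeds
    \<open>m n + n\<close> and all clauses fit.\<close>
  define D where "D n = (m n + n) div T n + 1" for n
  \<comment> \<open>The \<open>+ 1\<close> makes the claimed error bound hold for every \<open>n\<close>, not only for large \<open>n\<close>.\<close>
  define k where "k n = n div s n ^ 4 + 1" for n
  define adv where "adv n = (2 * D n + 1) * L n" for n
  define coins where "coins n = k n * s n" for n
  define qb where "qb n = k n * (T n * L n)" for n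
  define la :: "nat \<Rightarrow> nat" where "la n = 2 ^ (coins n + qb n)" for n
  define lb where "lb n = 2 ^ s n * (T n * L n)" for n
  \<comment> \<open>Solved from n^(1 - \<delta>) = k, which holds exactly for n at least 2.\<close>
  define \<delta> where "\<delta> n = 1 - ln (real (k n)) / ln (real n)" for n
  \<comment> \<open>A common sublinear majorant, up to constants, for the advice, the coins, the
    queries and the exponents of both string lengths. It is \<open>k * s^3\<close> with
    \<open>k\<close> replaced by \<open>n / s^4 + 1\<close>.\<close>
  define h where "h n = real n / real (s n) + real (s n) ^ 3" for n
  have s2: "2 \<le> s n" for n
  proof (rule ccontr)
    assume "\<not> 2 \<le> s n"
    then have "(2::nat) ^ s n \<le> 2 ^ 1" by (intro power_increasing) auto
    then show False using s_ge[of n] by simp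
  qed
  have n_le: "n \<le> 2 ^ s n" for n by (rule order.trans[OF _ s_ge]) simp
  note s_asymp = log_scale_asymp[OF assms n_le s_le]

  have h: "h \<in> o(\<lambda>n. real n)"
  proof -
    have "(\<lambda>n. real n / real (s n)) \<in> o(\<lambda>n. real n)"
    proof (rule smalloI_tendsto)
      have "((\<lambda>n. inverse (real (s n))) \<longlongrightarrow> 0) at_top"
        using s_asymp(2) by (rule tendsto_inverse_0_at_top)
      then show "((\<lambda>n. real n / real (s n) / real n) \<longlongrightarrow> 0) at_top"
        by (rule Lim_transform_eventually)
          (rule eventually_mono[OF eventually_gt_at_top[of 0]], simp add: field_simps)
    qed (rule eventually_mono[OF eventually_gt_at_top[of 0]], simp)
    moreover have "(\<lambda>n. real (s n) ^ 3) \<in> O(\<lambda>n. ln (real n) ^ 3)"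
      using s_asymp(1) by (rule landau_o.big_power)
    then have "(\<lambda>n. real (s n) ^ 3) \<in> o(\<lambda>n. real n)"
      by (rule landau_o.big_small_trans) real_asymp
    ultimately show ?thesis unfolding h_def by (rule sum_in_smallo)
  qed
  have small: "f \<in> o(\<lambda>n. real n)"
    if "eventually (\<lambda>n. 0 \<le> f n \<and> f n \<le> c * h n) at_top" for f c
  proof -
    have "f \<in> O(h)"
      using that
      by (intro bigoI[of _ c]) (auto elim!: eventually_mono simp: h_def)
    then show ?thesis using h by (rule landau_o.big_small_trans)
  qed
  have L_le: "real (L n) \<le> 6 * real (s n)" for n
    using s2[of n] by (simp add: L_def)
  have k_le: "real (k n) \<le> real n / real (s n) ^ 4 + 1" for n
    using of_nat_div_le_of_nat[where 'a = real, of n "s n ^ 4"] by (simp add: k_def)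
  have TL_le: "real (T n * L n) \<le> 6 * real (s n) ^ 3" for n
  proof -
    have "real (T n * L n) \<le> real (s n) ^ 2 * (6 * real (s n))"
      unfolding of_nat_mult using L_le[of n] by (intro mult_mono) (auto simp: T_def)
    then show ?thesis by (simp add: power2_eq_square power3_eq_cube)
  qed
  have qb_le: "real (qb n) \<le> 6 * h n" for n
  proof -
    have "real (qb n) \<le> (real n / real (s n) ^ 4 + 1) * (6 * real (s n) ^ 3)"
      unfolding qb_def of_nat_mult[of "k n"] by (intro mult_mono k_le TL_le) auto
    also have "\<dots> = 6 * h n"
      using s2[of n] by (simp add: h_def field_simps eval_nat_numeral)
    finally show ?thesis .
  qed
  have coins_le: "coins n \<le> qb n" for n
  proof -
    have "1 \<le> s n" using s2[of n] by simp
    then have "s n * 1 \<le> s n ^ 2 * L n"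
      by (intro mult_mono) (auto simp: L_def power2_eq_square)
    then show ?thesis unfolding coins_def qb_def T_def by (intro mult_left_mono) auto
  qed
  have "little_o_n qb"
    unfolding little_o_n_def by (rule small[of _ 6]) (simp add: qb_le)
  moreover have "little_o_n coins"
    unfolding little_o_n_def
  proof (rule small[of _ 6], intro always_eventually allI conjI)
    show "real (coins n) \<le> 6 * h n" for n
      using coins_le[of n] qb_le[of n] by linarith
  qed simp
  moreover have "two_to_little_o_n la"
    unfolding two_to_little_o_n_def
  proof (intro exI[of _ "\<lambda>n. real (coins n + qb n)"] conjI allI)
    have "real (coins n + qb n) \<le> 12 * h n" for n
      using coins_le[of n] qb_le[of n] by linarith
    then show "(\<lambda>n. real (coins n + qb n)) \<in> o(real)"
      by (intro small[of _ 12]) auto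
  qed (simp only: la_def powr_realpow of_nat_power of_nat_numeral zero_less_numeral)
  moreover have "two_to_little_o_n lb"
    unfolding two_to_little_o_n_def
  proof (intro exI[of _ "\<lambda>n. real (s n) + log 2 (real (T n * L n))"] conjI allI)
    \<comment> \<open>The definition asks for an exact power of 2 at every \<open>n\<close>, so the
      logarithm must be of a positive number even for small \<open>n\<close>.\<close>
    have TL: "real (T n * L n) \<ge> 1" for n
      using s2[of n] by (simp add: T_def L_def flip: of_nat_mult)
    show "real (lb n) = 2 powr (real (s n) + log 2 (real (T n * L n)))" for n
      using TL[of n] by (simp add: lb_def powr_add powr_realpow)
    have "real (s n) + log 2 (real (T n * L n)) \<le> 7 * h n" for n
    proof -
      have "log 2 (real (T n * L n)) \<le> real (T n * L n)"
        using TL[of n] less_exp[of "T n * L n"] by (intro log2_of_power_le) linarith+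
      moreover have "real (s n) \<le> real (s n) ^ 3"
        using s2[of n] by (intro self_le_power) auto
      moreover have "real (s n) ^ 3 \<le> h n" by (simp add: h_def)
      ultimately show ?thesis using TL_le[of n] by linarith
    qed
    moreover have "0 \<le> real (s n) + log 2 (real (T n * L n))" for n
    proof -
      have "0 \<le> log 2 (real (T n * L n))"
        using TL[of n] by (subst zero_le_log_cancel_iff) linarith+
      then show ?thesis by simp
    qed
    ultimately show "(\<lambda>n. real (s n) + log 2 (real (T n * L n))) \<in> o(real)"
      by (intro small[of _ 7] always_eventually) blast
  qed
  moreover have "little_o_n adv"
  proof -
    obtain c where c: "eventually (\<lambda>n. real (m n) \<le> c * real n) at_top"
      using landau_o.bigE[OF assms] by auto
    \<comment> \<open>The constant is the sum of the coefficients \<open>12 * (|c| + 1)\<close> and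
      18 that arise below, so it dominates both.\<close>
    have "eventually (\<lambda>n. 0 \<le> real (adv n) \<and> real (adv n) \<le> (12 * \<bar>c\<bar> + 30) * h n) at_top"
      using c
    proof eventually_elim
      case (elim n)
      have mn: "real (m n) \<le> \<bar>c\<bar> * real n"
        using elim by (meson abs_ge_self mult_right_mono of_nat_0_le_iff order.trans)
      have sp: "real (s n) > 0" using s2[of n] by simp
      have "real (D n) \<le> real (m n + n) / real (s n) ^ 2 + 1"
        using of_nat_div_le_of_nat[where 'a = real, of "m n + n" "T n"] by (simp add: D_def T_def)
      also have "\<dots> \<le> (\<bar>c\<bar> + 1) * real n / real (s n) ^ 2 + 1"
        using mn by (intro add_right_mono divide_right_mono) (auto simp: algebra_simps)
      finally have "real (2 * D n + 1) \<le> 2 * ((\<bar>c\<bar> + 1) * real n / real (s n) ^ 2) + 3" by simp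
      then have "real (adv n) \<le> (2 * ((\<bar>c\<bar> + 1) * real n / real (s n) ^ 2) + 3) * (6 * real (s n))"
        unfolding adv_def of_nat_mult[of "2 * D n + 1"] using L_le by (intro mult_mono) auto
      also have "\<dots> = 12 * (\<bar>c\<bar> + 1) * (real n / real (s n)) + 18 * real (s n) ^ 1"
        using sp by (simp add: field_simps power2_eq_square)
      also have "\<dots> \<le> (12 * \<bar>c\<bar> + 30) * (real n / real (s n)) + (12 * \<bar>c\<bar> + 30) * real (s n) ^ 3"
        using s2[of n] by (intro add_mono mult_mono power_increasing) auto
      also have "\<dots> = (12 * \<bar>c\<bar> + 30) * h n" by (simp add: h_def algebra_simps)
      finally show ?case by simp
    qed
    then show ?thesis unfolding little_o_n_def by (rule small)
  qed
  moreover have "\<delta> \<in> o(\<lambda>n. 1)"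
  proof (rule smalloI_tendsto)
    obtain c where c: "c > 0" "eventually (\<lambda>n. real (s n) \<le> c * \<bar>ln (real n)\<bar>) at_top"
      using landau_o.bigE[OF s_asymp(1)] by auto
    \<comment> \<open>Here \<delta> is ln (n / k) / ln n. From \<open>k \<le> n\<close> it is
      nonnegative; from \<open>n < s^4 * k\<close> it is at most 4 ln s / ln n, which is of order ln
      ln n / ln n.\<close>
    have bounds: "eventually (\<lambda>n. 0 \<le> \<delta> n \<and> \<delta> n \<le> 4 * ln (c * ln (real n)) / ln (real n)) at_top"
      using c(2) eventually_ge_at_top[of 2]
    proof eventually_elim
      case (elim n)
      have lnn: "ln (real n) > 0" using elim(2) by simp
      have sp: "real (s n) > 0" using s2[of n] by simp
      have "s n ^ 4 \<ge> 2 ^ 4" using s2 by (intro power_mono) auto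
      then have "n div s n ^ 4 \<le> n div 2 ^ 4" by (intro div_le_mono2) auto
      then have "k n \<le> n" using elim(2) by (simp add: k_def)
      then have "ln (real (k n)) \<le> ln (real n)" by (simp add: k_def)
      then have "0 \<le> \<delta> n" using lnn by (simp add: \<delta>_def)
      have "n < s n ^ 4 * k n"
        using dividend_less_times_div[of "s n ^ 4" n] s2[of n] by (simp add: k_def)
      then have "real n \<le> real (s n) ^ 4 * real (k n)"
        by (metis less_imp_le of_nat_le_iff of_nat_mult of_nat_power)
      then have "ln (real n) \<le> ln (real (s n) ^ 4 * real (k n))"
        using elim(2) by (intro ln_mono) auto
      also have "\<dots> = 4 * ln (real (s n)) + ln (real (k n))"
        using sp by (subst ln_mult) (auto simp: k_def ln_realpow)
      also have "ln (real (s n)) \<le> ln (c * ln (real n))"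
        using elim(1) sp lnn by (intro ln_mono) auto
      finally have "ln (real n) - ln (real (k n)) \<le> 4 * ln (c * ln (real n))" by simp
      moreover have "\<delta> n = (ln (real n) - ln (real (k n))) / ln (real n)"
        using lnn by (simp add: \<delta>_def diff_divide_distrib)
      ultimately have "\<delta> n \<le> 4 * ln (c * ln (real n)) / ln (real n)"
        using lnn by (simp add: divide_right_mono)
      with \<open>0 \<le> \<delta> n\<close> show ?case by simp
    qed
    have "(\<delta> \<longlongrightarrow> 0) at_top"
    proof (rule tendsto_sandwich)
      show "eventually (\<lambda>n. 0 \<le> \<delta> n) at_top"
        using bounds by eventually_elim simp
      show "eventually (\<lambda>n. \<delta> n \<le> 4 * ln (c * ln (real n)) / ln (real n)) at_top"
        using bounds by eventually_elim simp
      show "((\<lambda>n. 4 * ln (c * ln (real n)) / ln (real n)) \<longlongrightarrow> 0) at_top"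
        using c(1) by real_asymp
    qed simp
    then show "((\<lambda>n. \<delta> n / 1) \<longlongrightarrow> 0) at_top" by simp
  qed simp
  \<comment> \<open>The error is stated with \<open>k n\<close>; the passage to \<delta> is a
    separate estimate in \<open>n\<close> alone.\<close>
  moreover define good where
    "good \<phi> P \<longleftrightarrow> (let n = num_vars \<phi> in
       well_formed_on P \<phi> (adv n) (la n) (lb n) (coins n) (qb n) \<and>
       (\<forall>\<alpha> \<in> bitstrings (n div 2). \<forall>\<beta>.
          (satisfies (\<alpha> @ \<beta>) \<phi> \<longrightarrow>
             (\<exists>\<mu> \<in> bitstrings (adv n). \<forall>r \<in> bitstrings (coins n).
                accepts P \<phi> (alice P \<phi> \<alpha> \<mu>) (bob P \<phi> \<beta>) r)) \<and>
          (\<not> satisfies (\<alpha> @ \<beta>) \<phi> \<longrightarrow>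
             (\<forall>\<mu>. reject_prob (coins n) P \<phi> (alice P \<phi> \<alpha> \<mu>) (bob P \<phi> \<beta>) \<ge> 1 - 1 / 2 ^ k n))))"
    for \<phi> P
  have ex: "\<exists>P. good \<phi> P" if "length (clauses \<phi>) \<le> m (num_vars \<phi>)" for \<phi>
  proof -
    define n where "n = num_vars \<phi>"
    obtain q :: nat where q: "prime q" "4 ^ s n < q" "q \<le> 2 ^ L n"
      using exists_prime_between_powers[of "s n"] unfolding L_def by blast
    have "(2::nat) ^ s n \<le> 4 ^ s n" by (rule power_mono) auto
    then have "2 ^ s n \<le> q" using q by linarith
    \<comment> \<open>This gives \<open>T n \<le> 4 ^ s n\<close>, which is below \<open>q\<close>:
      the column counts cannot wrap around.\<close>
    have "s n * s n \<le> 2 ^ s n * 2 ^ s n" by (intro mult_mono) (auto intro: less_imp_le)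
    then have "T n \<le> 4 ^ s n" by (simp add: T_def power2_eq_square flip: power_mult_distrib)
    then have "T n < q" using q by linarith
    have "4 * D n \<le> 4 * (m n + n + 1)"
      unfolding D_def by (intro mult_left_mono add_right_mono div_le_dividend) simp
    also note s_ge
    finally have "4 * D n \<le> 2 ^ s n" .
    have "m n + n < T n * D n"
      using dividend_less_times_div[of "T n" "m n + n"] s2[of n] by (simp add: T_def D_def)
    then have "length (clauses \<phi>) \<le> T n * D n" using that by (simp add: n_def)
    from formula_protocol[OF q(1) q(3) \<open>2 ^ s n \<le> q\<close> \<open>T n < q\<close> \<open>4 * D n \<le> 2 ^ s n\<close> this, of "k n"]
    show ?thesis
      unfolding good_def Let_def n_def[symmetric] adv_def la_def lb_def coins_def qb_def by metis
  qed
  \<comment> \<open>All components of a protocol receive \<phi>, so each can consult the protocol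
    chosen for that formula, and Alice and Bob still see only their own inputs.\<close>
  define choice where "choice \<phi> = (SOME P. good \<phi> P)" for \<phi>
  have choice: "good \<phi> (choice \<phi>)" if "length (clauses \<phi>) \<le> m (num_vars \<phi>)" for \<phi>
    unfolding choice_def using ex[OF that] by (rule someI_ex)
  define P :: protocol where "P = \<lparr>alice = (\<lambda>\<phi>. alice (choice \<phi>) \<phi>), bob = (\<lambda>\<phi>. bob (choice \<phi>) \<phi>),
      bob_queries = (\<lambda>\<phi>. bob_queries (choice \<phi>) \<phi>),
      alice_query = (\<lambda>\<phi>. alice_query (choice \<phi>) \<phi>), decision = (\<lambda>\<phi>. decision (choice \<phi>) \<phi>)\<rparr>"
  have accepts_P: "accepts P \<phi> = accepts (choice \<phi>) \<phi>" for \<phi>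
    by (simp add: fun_eq_iff accepts_def P_def)
  have P_good: "good \<phi> P" if "length (clauses \<phi>) \<le> m (num_vars \<phi>)" for \<phi>
    using choice[OF that]
    unfolding good_def well_formed_on_def reject_prob_def accepts_P by (simp add: P_def)
  have error: "1 - 1 / 2 powr (real n powr (1 - \<delta> n)) \<le> 1 - 1 / 2 ^ k n" if "even n" for n
  proof -
    \<comment> \<open>For positive even \<open>n\<close> this is an equality by the choice of
      \<delta>; for \<open>n = 0\<close> the left side is 0 because
      \<open>0 powr x = 0\<close>.\<close>
    have "real n powr (1 - \<delta> n) \<le> real (k n)"
    proof (cases "n = 0")
      case False
      with that have "n \<ge> 2" by (cases "n = 1") auto
      then show ?thesis by (simp add: \<delta>_def powr_def k_def)
    qed simp
    then have "2 powr (real n powr (1 - \<delta> n)) \<le> 2 powr real (k n)" by (intro powr_mono) auto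
    then show ?thesis by (simp add: powr_realpow frac_le)
  qed
  have "\<forall>(\<phi> :: cnf) (n :: nat).
         wf_cnf \<phi> \<and> num_vars \<phi> = n \<and> even n \<and> length (clauses \<phi>) \<le> m n \<longrightarrow>
           well_formed_on P \<phi> (adv n) (la n) (lb n) (coins n) (qb n) \<and>
           (\<forall>\<alpha> \<in> bitstrings (n div 2). \<forall>\<beta> \<in> bitstrings (n div 2).
              (satisfies (\<alpha> @ \<beta>) \<phi> \<longrightarrow>
                 (\<exists>\<mu> \<in> bitstrings (adv n). \<forall>r \<in> bitstrings (coins n).
                    accepts P \<phi> (alice P \<phi> \<alpha> \<mu>) (bob P \<phi> \<beta>) r)) \<and>
              (\<not> satisfies (\<alpha> @ \<beta>) \<phi> \<longrightarrow>
                 (\<forall>\<mu> \<in> bitstrings (adv n).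
                    reject_prob (coins n) P \<phi> (alice P \<phi> \<alpha> \<mu>) (bob P \<phi> \<beta>)
                      \<ge> 1 - 1 / 2 powr (real n powr (1 - \<delta> n)))))"
    using P_good error unfolding good_def Let_def by (meson order.trans)
  ultimately show ?thesis by blast
qed

end
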